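(* For every integer $n\ge 1$ there exist finite solvable groups $G_{1},G_{2},\ldots ,G_{n}$ of pairwise coprime order such that $d(G_{i})=2$ and $G_{i}/G_{i}^{\prime }$ is cyclic for all $1\leq i\leq n$, and such that the free product $\Gamma =G_{1}\ast G_{2}\ast \cdots \ast G_{n}$ satisfies $$d\left( \widehat{\Gamma }\right) \geq n+1.$$
   Context: For a group $G$, $d(G)$ denotes the minimal number of generators of $G$, and $G'$ denotes the derived (commutator) subgroup. For a group $\Gamma$, $\widehat{\Gamma}$ denotes its profinite completion. For a profinite group $P$, $d(P)$ denotes the minimal number of topological generators of $P$, i.e. the smallest cardinality of a subset generating a dense subgroup of $P$. *)

theory Defs
  imports
    "HOL-Algebra.Solvable_Groups"
    "HOL-Algebra.Elementary_Groups"
    "HOL-Algebra.Product_Groups"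
    "HOL-Library.Extended_Nat"
    "HOL-Analysis.Function_Topology"
begin

section \<open>Minimal numbers of generators\<close>

text \<open>All infinite cardinals are identified with \<open>\<infinity>\<close>.\<close>

definition set_size :: "'a set \<Rightarrow> enat" where
  "set_size X = (if finite X then enat (card X) else \<infinity>)"

definition min_gens :: "('a, 'm) monoid_scheme \<Rightarrow> enat" where
  "min_gens G = (INF X \<in> {X. X \<subseteq> carrier G \<and> generate G X = carrier G}. set_size X)"

definition min_top_gens :: "('a, 'm) monoid_scheme \<Rightarrow> 'a topology \<Rightarrow> enat" where
  "min_top_gens P T =
     (INF X \<in> {X. X \<subseteq> carrier P \<and> T closure_of (generate P X) = carrier P}. set_size X)"

section \<open>Free products\<close>

text \<open>
  The free product of the groups \<open>G i\<close>, \<open>i \<in> I\<close>, consists of the words in the disjoint union of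
  the carriers, modulo the congruence generated by deleting identity letters and multiplying
  adjacent letters coming from the same factor.
\<close>

definition fp_words :: "'i set \<Rightarrow> ('i \<Rightarrow> ('a, 'm) monoid_scheme) \<Rightarrow> ('i \<times> 'a) list set" where
  "fp_words I G = lists (SIGMA i:I. carrier (G i))"

inductive fp_equiv ::
    "'i set \<Rightarrow> ('i \<Rightarrow> ('a, 'm) monoid_scheme) \<Rightarrow> ('i \<times> 'a) list \<Rightarrow> ('i \<times> 'a) list \<Rightarrow> bool"
  for I G where
    refl: "u \<in> fp_words I G \<Longrightarrow> fp_equiv I G u u"
  | sym: "fp_equiv I G u v \<Longrightarrow> fp_equiv I G v u"
  | trans: "fp_equiv I G u v \<Longrightarrow> fp_equiv I G v w \<Longrightarrow> fp_equiv I G u w"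
  | append: "fp_equiv I G u u' \<Longrightarrow> fp_equiv I G v v' \<Longrightarrow> fp_equiv I G (u @ v) (u' @ v')"
  | one: "i \<in> I \<Longrightarrow> fp_equiv I G [(i, \<one>\<^bsub>G i\<^esub>)] []"
  | mult: "i \<in> I \<Longrightarrow> x \<in> carrier (G i) \<Longrightarrow> y \<in> carrier (G i) \<Longrightarrow>
           fp_equiv I G [(i, x), (i, y)] [(i, x \<otimes>\<^bsub>G i\<^esub> y)]"

definition fp_rel ::
    "'i set \<Rightarrow> ('i \<Rightarrow> ('a, 'm) monoid_scheme) \<Rightarrow> ('i \<times> 'a) list rel" where
  "fp_rel I G = {(u, v). fp_equiv I G u v}"

definition free_product ::
    "'i set \<Rightarrow> ('i \<Rightarrow> ('a, 'm) monoid_scheme) \<Rightarrow> ('i \<times> 'a) list set monoid" where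
  "free_product I G =
     \<lparr>carrier = fp_words I G // fp_rel I G,
      mult = (\<lambda>A B. \<Union>u\<in>A. \<Union>v\<in>B. fp_rel I G `` {u @ v}),
      one = fp_rel I G `` {[]}\<rparr>"

lemma fp_equiv_words:
  assumes "\<And>i. i \<in> I \<Longrightarrow> group (G i)" "fp_equiv I G u v"
  shows "u \<in> fp_words I G \<and> v \<in> fp_words I G"
  using assms(2) by induction (auto simp: fp_words_def assms(1) group.is_monoid monoid.m_closed)

lemma equiv_fp_rel:
  assumes "\<And>i. i \<in> I \<Longrightarrow> group (G i)"
  shows "equiv (fp_words I G) (fp_rel I G)"
proof (rule equivI)
  show "fp_rel I G \<subseteq> fp_words I G \<times> fp_words I G"
    using fp_equiv_words[of I G, OF assms] by (auto simp: fp_rel_def)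
  show "refl_on (fp_words I G) (fp_rel I G)"
    by (auto simp: refl_on_def fp_rel_def intro: fp_equiv.refl)
  show "sym (fp_rel I G)"
    by (rule symI) (simp add: fp_rel_def fp_equiv.sym)
  show "trans (fp_rel I G)"
    unfolding trans_def fp_rel_def by (blast intro: fp_equiv.trans)
qed

lemma free_product_mult:
  assumes G: "\<And>i. i \<in> I \<Longrightarrow> group (G i)" and "u \<in> fp_words I G" "v \<in> fp_words I G"
  shows "(fp_rel I G `` {u}) \<otimes>\<^bsub>free_product I G\<^esub> (fp_rel I G `` {v}) = fp_rel I G `` {u @ v}"
proof -
  note E = equiv_fp_rel[of I G, OF G]
  have "fp_rel I G `` {u' @ v'} = fp_rel I G `` {u @ v}"
    if "u' \<in> fp_rel I G `` {u}" "v' \<in> fp_rel I G `` {v}" for u' v'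
  proof -
    have "(u @ v, u' @ v') \<in> fp_rel I G"
      using that by (simp add: fp_rel_def fp_equiv.append)
    then show ?thesis using equiv_class_eq[OF E] by metis
  qed
  moreover have "u \<in> fp_rel I G `` {u}" "v \<in> fp_rel I G `` {v}"
    using assms by (auto simp: fp_rel_def intro: fp_equiv.refl)
  ultimately have "(\<Union>u'\<in>fp_rel I G `` {u}. \<Union>v'\<in>fp_rel I G `` {v}. fp_rel I G `` {u' @ v'})
      = fp_rel I G `` {u @ v}"
    by blast
  then show ?thesis by (simp add: free_product_def)
qed

lemma group_free_product:
  assumes G: "\<And>i. i \<in> I \<Longrightarrow> group (G i)"
  shows "group (free_product I G)"
proof -
  have app: "u @ v \<in> fp_words I G" if "u \<in> fp_words I G" "v \<in> fp_words I G" for u v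
    using that by (auto simp: fp_words_def)
  have nil: "[] \<in> fp_words I G" by (simp add: fp_words_def)
  have inv: "\<exists>v \<in> fp_words I G. fp_equiv I G (v @ u) []" if "u \<in> fp_words I G" for u
    using that
  proof (induction u)
    case Nil
    then show ?case using nil fp_equiv.refl by fastforce
  next
    case (Cons a u)
    obtain i x where a: "a = (i, x)" by (cases a)
    from Cons.prems a have ix: "i \<in> I" "x \<in> carrier (G i)" and u: "u \<in> fp_words I G"
      by (auto simp: fp_words_def)
    interpret group "G i" using G ix by simp
    obtain v where v: "v \<in> fp_words I G" "fp_equiv I G (v @ u) []"
      using Cons.IH u by blast
    have "fp_equiv I G [(i, inv\<^bsub>G i\<^esub> x), (i, x)] []"
      using fp_equiv.trans[OF fp_equiv.mult[of i I "inv\<^bsub>G i\<^esub> x" G x] ] fp_equiv.one[of i I G] ix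
      by simp
    then have "fp_equiv I G (v @ ([(i, inv\<^bsub>G i\<^esub> x), (i, x)] @ u)) (v @ ([] @ u))"
      using u v by (intro fp_equiv.append fp_equiv.refl) auto
    then have "fp_equiv I G ((v @ [(i, inv\<^bsub>G i\<^esub> x)]) @ a # u) []"
      using fp_equiv.trans[OF _ v(2)] by (simp add: a)
    moreover have "v @ [(i, inv\<^bsub>G i\<^esub> x)] \<in> fp_words I G"
      using v ix by (auto simp: fp_words_def)
    ultimately show ?case by blast
  qed
  have C: "carrier (free_product I G) = (\<lambda>u. fp_rel I G `` {u}) ` fp_words I G"
    by (auto simp: free_product_def quotient_def)
  have O: "\<one>\<^bsub>free_product I G\<^esub> = fp_rel I G `` {[]}"
    by (simp add: free_product_def)
  show ?thesis
  proof (rule groupI)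
    fix A assume "A \<in> carrier (free_product I G)"
    then obtain u where u: "u \<in> fp_words I G" "A = fp_rel I G `` {u}" by (auto simp: C)
    obtain v where v: "v \<in> fp_words I G" "fp_equiv I G (v @ u) []" using inv u by blast
    have "fp_rel I G `` {v @ u} = fp_rel I G `` {[]}"
      using v(2) by (intro equiv_class_eq[OF equiv_fp_rel[of I G, OF G]]) (auto simp: fp_rel_def)
    then show "\<exists>B\<in>carrier (free_product I G). B \<otimes>\<^bsub>free_product I G\<^esub> A = \<one>\<^bsub>free_product I G\<^esub>"
      using u v by (auto simp: C O free_product_mult[of I G, OF G])
  qed (auto simp: C O free_product_mult[of I G, OF G] app nil)
qed

section \<open>Profinite completions\<close>

definition fin_index_normal :: "('a, 'm) monoid_scheme \<Rightarrow> 'a set set" where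
  "fin_index_normal G = {N. N \<lhd> G \<and> finite (rcosets\<^bsub>G\<^esub> N)}"

text \<open>
  The inverse limit of the finite quotients \<open>G Mod N\<close>. For \<open>N \<subseteq> M\<close> the canonical projection
  \<open>G Mod N \<rightarrow> G Mod M\<close> sends a coset \<open>X\<close> of \<open>N\<close> to the coset \<open>M <#> X\<close> of \<open>M\<close> containing it.
\<close>

definition profinite_completion ::
    "('a, 'm) monoid_scheme \<Rightarrow> ('a set \<Rightarrow> 'a set) monoid" where
  "profinite_completion G =
     (product_group (fin_index_normal G) (\<lambda>N. G Mod N))
       \<lparr>carrier := {f \<in> \<Pi>\<^sub>E N \<in> fin_index_normal G. carrier (G Mod N).
          \<forall>N \<in> fin_index_normal G. \<forall>M \<in> fin_index_normal G.
            N \<subseteq> M \<longrightarrow> f M = M <#>\<^bsub>G\<^esub> f N}\<rparr>"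

definition profinite_completion_topology ::
    "('a, 'm) monoid_scheme \<Rightarrow> ('a set \<Rightarrow> 'a set) topology" where
  "profinite_completion_topology G =
     subtopology
       (product_topology (\<lambda>N. discrete_topology (carrier (G Mod N))) (fin_index_normal G))
       (carrier (profinite_completion G))"

lemma topspace_profinite_completion_topology:
  "topspace (profinite_completion_topology G) = carrier (profinite_completion G)"
  by (auto simp: profinite_completion_topology_def profinite_completion_def)

lemma set_mult_rcoset_of_subgroup:
  assumes "N \<lhd> G" "M \<lhd> G" "N \<subseteq> M" "x \<in> carrier G"
  shows "M <#>\<^bsub>G\<^esub> (N #>\<^bsub>G\<^esub> x) = M #>\<^bsub>G\<^esub> x"
proof -
  interpret N: normal N G by fact
  interpret M: normal M G by fact
  have "M <#>\<^bsub>G\<^esub> N = M"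
  proof
    show "M <#>\<^bsub>G\<^esub> N \<subseteq> M"
      using assms(3) subgroup.m_closed[OF M.subgroup_axioms] by (auto simp: set_mult_def)
    show "M \<subseteq> M <#>\<^bsub>G\<^esub> N"
    proof
      fix m assume "m \<in> M"
      then have "m = m \<otimes>\<^bsub>G\<^esub> \<one>\<^bsub>G\<^esub>" using M.mem_carrier by simp
      then show "m \<in> M <#>\<^bsub>G\<^esub> N"
        unfolding set_mult_def using \<open>m \<in> M\<close> subgroup.one_closed[OF N.subgroup_axioms] by blast
    qed
  qed
  then show ?thesis
    using N.setmult_rcos_assoc[of M N x] assms(4) M.subset N.subset by simp
qed

lemma group_profinite_completion:
  fixes G (structure)
  assumes "group G"
  shows "group (profinite_completion G)"
proof -
  interpret group G by fact
  let ?F = "fin_index_normal G"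
  let ?P = "product_group ?F (\<lambda>N. G Mod N)"
  let ?C = "carrier (profinite_completion G)"
  have fac: "group (G Mod N)" if "N \<in> ?F" for N
    using that by (simp add: fin_index_normal_def normal.factorgroup_is_group)
  interpret P: group ?P using fac by simp
  have CP: "?C \<subseteq> carrier ?P" by (auto simp: profinite_completion_def)
  have hom: "(\<lambda>X. M <#> X) \<in> hom (G Mod N) (G Mod M)"
    if "N \<in> ?F" "M \<in> ?F" "N \<subseteq> M" for N M
  proof -
    interpret N: normal N G using that by (simp add: fin_index_normal_def)
    interpret M: normal M G using that by (simp add: fin_index_normal_def)
    note [simp] = set_mult_rcoset_of_subgroup[OF N.normal_axioms M.normal_axioms that(3)]
    show ?thesis
      by (rule homI) (auto simp: FactGroup_def RCOSETS_def N.rcos_sum M.rcos_sum)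
  qed
  have C: "f \<in> ?C \<longleftrightarrow> f \<in> carrier ?P \<and> (\<forall>N\<in>?F. \<forall>M\<in>?F. N \<subseteq> M \<longrightarrow> f M = M <#> f N)" for f
    by (auto simp: profinite_completion_def)
  have "subgroup ?C ?P"
  proof (rule P.subgroupI)
    show "?C \<noteq> {}"
    proof -
      have "\<one>\<^bsub>?P\<^esub> \<in> ?C"
        unfolding C using hom_one[OF hom fac fac] P.one_closed by (simp add: FactGroup_def)
      then show ?thesis by blast
    qed
  next
    fix f assume f: "f \<in> ?C"
    then have fP: "f \<in> carrier ?P" using CP by blast
    then have fN: "f N \<in> carrier (G Mod N)" if "N \<in> ?F" for N
      using that by auto
    have i: "(inv\<^bsub>?P\<^esub> f) = (\<lambda>N\<in>?F. inv\<^bsub>G Mod N\<^esub> f N)"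
      using fP fac by (simp add: inv_product_group)
    have "(inv\<^bsub>?P\<^esub> f) M = M <#> (inv\<^bsub>?P\<^esub> f) N" if "N \<in> ?F" "M \<in> ?F" "N \<subseteq> M" for N M
    proof -
      have h: "group_hom (G Mod N) (G Mod M) (\<lambda>X. M <#> X)"
        using group_hom.intro[OF fac[OF that(1)] fac[OF that(2)]] group_hom_axioms.intro[OF hom[OF that]]
        by blast
      have "f M = M <#> f N" using f that unfolding C by blast
      then have "inv\<^bsub>G Mod M\<^esub> f M = M <#> inv\<^bsub>G Mod N\<^esub> f N"
        using group_hom.hom_inv[OF h fN[OF that(1)]] by metis
      then show ?thesis using that by (simp only: i restrict_apply' if_True)
    qed
    then show "inv\<^bsub>?P\<^esub> f \<in> ?C"
      unfolding C using P.inv_closed[OF fP] by blast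
  next
    fix f g assume fg: "f \<in> ?C" "g \<in> ?C"
    then have fP: "f \<in> carrier ?P" "g \<in> carrier ?P" using CP by blast+
    then have fN: "f N \<in> carrier (G Mod N)" "g N \<in> carrier (G Mod N)" if "N \<in> ?F" for N
      using that by auto
    have "(f \<otimes>\<^bsub>?P\<^esub> g) M = M <#> (f \<otimes>\<^bsub>?P\<^esub> g) N" if "N \<in> ?F" "M \<in> ?F" "N \<subseteq> M" for N M
    proof -
      have "M <#> (f N \<otimes>\<^bsub>G Mod N\<^esub> g N) = (M <#> f N) \<otimes>\<^bsub>G Mod M\<^esub> (M <#> g N)"
        using hom_mult[OF hom[OF that] fN[OF that(1)]] .
      moreover have "f M = M <#> f N" "g M = M <#> g N" using fg that unfolding C by blast+
      ultimately have "f M \<otimes>\<^bsub>G Mod M\<^esub> g M = M <#> (f N \<otimes>\<^bsub>G Mod N\<^esub> g N)"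
        by (simp only:)
      then show ?thesis using that by (simp only: mult_product_group restrict_apply')
    qed
    then show "f \<otimes>\<^bsub>?P\<^esub> g \<in> ?C"
      unfolding C using P.m_closed[OF fP] by blast
  qed (use CP in auto)
  then have "group (?P\<lparr>carrier := ?C\<rparr>)"
    by (rule P.subgroup_imp_group)
  then show ?thesis
    by (simp add: profinite_completion_def)
qed

end

theory Submission
  imports Defs "HOL-Algebra.Bij" "HOL-Number_Theory.Pocklington" "HOL-Library.Nat_Bijection"
    "HOL-Library.Numeral_Type"
begin

text \<open>
  If \<open>\<Gamma>\<close> acts linearly on a finite module \<open>V\<close>, a derivation \<open>\<Gamma> \<rightarrow> V\<close> factors through a finite quotient
  of \<open>\<Gamma>\<close> and is determined by its values on topological generators of the profinite completion, so
  \<open>d\<close> such generators allow at most \<open>|V| ^ d\<close> derivations. On the other hand, a derivation of a free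
  product is an arbitrary choice of a derivation on each factor. Take \<open>V = (\<int>/3) ^ m\<close>. Letting
  \<open>G 1 = S\<^sub>3\<close> act through the sign gives \<open>|V|\<^sup>2\<close> derivations. A group \<open>G i\<close> with \<open>i \<ge> 2\<close> that
  acts by permuting coordinates in free orbits of prime length \<open>q\<close> has at least the
  \<open>|V| ^ (1 - 1 / q)\<close> inner derivations. If the primes grow fast enough, then \<open>\<Sum> 1 / q < 1\<close>
  and the product exceeds \<open>|V| ^ n\<close>. Derivations are handled as homomorphisms into the
  affine permutations of \<open>{..<m} \<times> \<int>/3\<close>.
\<close>

section \<open>The metacyclic factors\<close>

text \<open>
  The semidirect product of \<open>\<int>/(2 ^ q - 1)\<close> by \<open>\<int>/q\<close>, whose generator acts as doubling; the
  pair \<open>(b, k)\<close> stands for the map \<open>x \<mapsto> 2 ^ k * x + b\<close>. For \<open>q = 2\<close> this is \<open>S\<^sub>3\<close>.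
\<close>

definition metacyclic :: "nat \<Rightarrow> nat monoid" where
  "metacyclic q =
     \<lparr>carrier = prod_encode ` ({..<2 ^ q - 1} \<times> {..<q}),
      monoid.mult = (\<lambda>x y. case (prod_decode x, prod_decode y) of ((b, k), (c, l)) \<Rightarrow>
        prod_encode ((b + 2 ^ k * c) mod (2 ^ q - 1), (k + l) mod q)),
      one = prod_encode (0, 0)\<rparr>"

lemma metacyclic_mem [simp]:
  "prod_encode (b, k) \<in> carrier (metacyclic q) \<longleftrightarrow> b < 2 ^ q - 1 \<and> k < q"
  by (auto simp: metacyclic_def image_iff)

lemma metacyclicE:
  assumes "x \<in> carrier (metacyclic q)"
  obtains b k where "x = prod_encode (b, k)" "b < 2 ^ q - 1" "k < q"
  using assms by (auto simp: metacyclic_def)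

lemma metacyclic_mult [simp]:
  "prod_encode (b, k) \<otimes>\<^bsub>metacyclic q\<^esub> prod_encode (c, l)
    = prod_encode ((b + 2 ^ k * c) mod (2 ^ q - 1), (k + l) mod q)"
  by (simp add: metacyclic_def)

lemma metacyclic_one [simp]: "\<one>\<^bsub>metacyclic q\<^esub> = prod_encode (0, 0)"
  by (simp add: metacyclic_def)

lemma order_metacyclic: "order (metacyclic q) = (2 ^ q - 1) * q"
  by (simp add: order_def metacyclic_def card_image[OF inj_prod_encode])

lemma finite_metacyclic: "finite (carrier (metacyclic q))"
  by (simp add: metacyclic_def)

context
  fixes q :: nat
  assumes q: "q \<ge> 2"
begin

private abbreviation "N \<equiv> 2 ^ q - (1 :: nat)"

lemma mersenne_ge: "N \<ge> 3"
proof -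
  have "(2::nat) ^ 2 \<le> 2 ^ q" using q by (intro power_increasing) auto
  then show ?thesis by simp
qed

lemma mersenne_cong: "[2 ^ q = 1] (mod N)"
  using cong_to_1_nat by (simp add: cong_altdef_nat)

text \<open>As \<open>2 ^ q\<close> is 1 modulo \<open>N\<close>, exponents of 2 may be reduced
  modulo \<open>q\<close>; this is what makes the multiplication associative.\<close>

lemma mersenne_cong_mod: "[2 ^ (k mod q) = 2 ^ k] (mod N)"
proof -
  have "[2 ^ k = (2 ^ q) ^ (k div q) * 2 ^ (k mod q)] (mod N)"
    by (simp flip: power_mult power_add)
  also have "[(2 ^ q) ^ (k div q) * 2 ^ (k mod q) = 1 ^ (k div q) * 2 ^ (k mod q)] (mod N)"
    by (intro cong_mult cong_pow mersenne_cong cong_refl)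
  finally show ?thesis by (simp add: cong_sym)
qed

lemma group_metacyclic: "group (metacyclic q)"
proof (rule groupI)
  fix x y z
  assume "x \<in> carrier (metacyclic q)" "y \<in> carrier (metacyclic q)" "z \<in> carrier (metacyclic q)"
  then obtain b k c l d m where
    x: "x = prod_encode (b, k)" "b < N" "k < q" and
    y: "y = prod_encode (c, l)" "c < N" "l < q" and
    z: "z = prod_encode (d, m)" "d < N" "m < q"
    by (elim metacyclicE)
  have "[(b + 2 ^ k * c) mod N + 2 ^ ((k + l) mod q) * d = (b + 2 ^ k * c) + 2 ^ (k + l) * d] (mod N)"
    by (intro cong_add cong_mult mersenne_cong_mod cong_refl cong_mod_leftI)
  also have "(b + 2 ^ k * c) + 2 ^ (k + l) * d = b + 2 ^ k * (c + 2 ^ l * d)"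
    by (simp add: algebra_simps power_add)
  also have "[b + 2 ^ k * (c + 2 ^ l * d) = b + 2 ^ k * ((c + 2 ^ l * d) mod N)] (mod N)"
    by (intro cong_add cong_mult cong_refl cong_mod_rightI)
  finally show "x \<otimes>\<^bsub>metacyclic q\<^esub> y \<otimes>\<^bsub>metacyclic q\<^esub> z = x \<otimes>\<^bsub>metacyclic q\<^esub> (y \<otimes>\<^bsub>metacyclic q\<^esub> z)"
    by (simp add: x y z cong_def mod_simps add.assoc)
next
  fix x assume "x \<in> carrier (metacyclic q)"
  then obtain b k where x: "x = prod_encode (b, k)" "b < N" "k < q" by (elim metacyclicE)
  show "\<exists>y\<in>carrier (metacyclic q). y \<otimes>\<^bsub>metacyclic q\<^esub> x = \<one>\<^bsub>metacyclic q\<^esub>"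
  proof
    \<comment> \<open>The map inverse to \<open>2 ^ k * x + b\<close> multiplies
      \<open>x - b\<close> by the \<open>- k\<close>-th power of 2; \<open>(q - k) mod q\<close>
      represents \<open>- k\<close> and \<open>N - b\<close> represents \<open>- b\<close>.\<close>
    let ?y = "prod_encode ((2 ^ ((q - k) mod q) * (N - b)) mod N, (q - k) mod q)"
    show "?y \<in> carrier (metacyclic q)" using mersenne_ge q by auto
    have "[2 ^ ((q - k) mod q) * (N - b) mod N + 2 ^ ((q - k) mod q) * b
        = 2 ^ ((q - k) mod q) * (N - b) + 2 ^ ((q - k) mod q) * b] (mod N)"
      by (intro cong_add cong_refl cong_mod_leftI)
    also have "2 ^ ((q - k) mod q) * (N - b) + 2 ^ ((q - k) mod q) * b = 2 ^ ((q - k) mod q) * N"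
      using x by (simp flip: distrib_left)
    finally have "(2 ^ ((q - k) mod q) * (N - b) mod N + 2 ^ ((q - k) mod q) * b) mod N = 0"
      by (simp add: cong_def)
    then show "?y \<otimes>\<^bsub>metacyclic q\<^esub> x = \<one>\<^bsub>metacyclic q\<^esub>"
      using x by (simp add: mod_simps)
  qed
qed (use mersenne_ge q in \<open>auto elim!: metacyclicE\<close>)

interpretation group "metacyclic q" by (rule group_metacyclic)

lemma metacyclic_pow_translation: 
  "prod_encode (1, 0) [^]\<^bsub>metacyclic q\<^esub> (m :: nat) = prod_encode (m mod N, 0)"
  by (induction m) (simp_all add: mod_simps)

lemma metacyclic_pow_rotation:
  "prod_encode (0, 1) [^]\<^bsub>metacyclic q\<^esub> (m :: nat) = prod_encode (0, m mod q)"
  by (induction m) (simp_all add: mod_simps)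

lemma metacyclic_decomp:
  assumes "b < N" "k < q"
  shows "prod_encode (b, k) = prod_encode (b, 0) \<otimes>\<^bsub>metacyclic q\<^esub>
    prod_encode (0, 1) [^]\<^bsub>metacyclic q\<^esub> k"
  unfolding metacyclic_pow_rotation using assms by simp

section \<open>Two generators, cyclic abelianization, solvability\<close>

text \<open>The translation by 1 and the doubling map generate. One generator would force
  commutativity, but these two do not commute, as 1 and 2 differ modulo
  \<open>N \<ge> 3\<close>.\<close>

lemma min_gens_metacyclic: "min_gens (metacyclic q) = 2"
proof (rule antisym)
  let ?X = "{prod_encode (1, 0), prod_encode (0, 1)}"
  have X: "?X \<subseteq> carrier (metacyclic q)" using mersenne_ge q by simp
  interpret S: subgroup "generate (metacyclic q) ?X" "metacyclic q"
    by (rule generate_is_subgroup[OF X])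
  have "x \<in> generate (metacyclic q) ?X" if x: "x \<in> carrier (metacyclic q)" for x
  proof -
    obtain b k where b: "x = prod_encode (b, k)" "b < N" "k < q" using x by (elim metacyclicE)
    then have "x = prod_encode (1, 0) [^]\<^bsub>metacyclic q\<^esub> b \<otimes>\<^bsub>metacyclic q\<^esub>
        prod_encode (0, 1) [^]\<^bsub>metacyclic q\<^esub> k"
      unfolding metacyclic_pow_translation using metacyclic_decomp[of b k] by simp
    moreover have "y [^]\<^bsub>metacyclic q\<^esub> m \<in> generate (metacyclic q) ?X" if "y \<in> ?X" for y and m :: nat
      using subgroup_int_pow_closed[OF S.subgroup_axioms generate.incl[OF that], of "int m"]
      by (simp only: int_pow_int)
    ultimately show ?thesis using S.m_closed by blast
  qed
  then have "generate (metacyclic q) ?X = carrier (metacyclic q)"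
    using generate_incl[OF X] by blast
  then have "min_gens (metacyclic q) \<le> set_size ?X"
    unfolding min_gens_def using X by (intro INF_lower) simp
  then show "min_gens (metacyclic q) \<le> 2"
    by (simp add: set_size_def numeral_eq_enat numeral_2_eq_2)
next
  show "2 \<le> min_gens (metacyclic q)"
    unfolding min_gens_def
  proof (rule INF_greatest, rule ccontr)
    fix X assume X: "X \<in> {X. X \<subseteq> carrier (metacyclic q) \<and> generate (metacyclic q) X = carrier (metacyclic q)}"
      and "\<not> 2 \<le> set_size X"
    then have "finite X" "card X < 2"
      by (auto simp: set_size_def numeral_eq_enat split: if_splits)
    then have "X = {} \<or> (\<exists>x. X = {x})"
      by (cases "card X") (auto simp: card_Suc_eq less_Suc_eq numeral_2_eq_2)
    then obtain x where x: "x \<in> carrier (metacyclic q)" "X \<subseteq> {x}"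
      using X by blast
    have "carrier (metacyclic q) \<subseteq> generate (metacyclic q) {x}"
      using X mono_generate[OF x(2)] by auto
    then have "prod_encode (1, 0) \<in> generate (metacyclic q) {x}"
        "prod_encode (0, 1) \<in> generate (metacyclic q) {x}"
      using mersenne_ge q by auto
    then obtain i j :: int where
      "prod_encode (1, 0) = x [^]\<^bsub>metacyclic q\<^esub> i" "prod_encode (0, 1) = x [^]\<^bsub>metacyclic q\<^esub> j"
      unfolding generate_pow[OF x(1)] by blast
    then have "prod_encode (1, 0) \<otimes>\<^bsub>metacyclic q\<^esub> prod_encode (0, 1)
        = prod_encode (0, 1) \<otimes>\<^bsub>metacyclic q\<^esub> prod_encode (1, 0)"
      using x(1) by (simp add: add.commute flip: int_pow_mult)
    then show False using mersenne_ge q by simp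
  qed
qed

text \<open>Conjugation by the doubling map squares a translation, so each translation is its own
  commutator with doubling.\<close>

lemma metacyclic_translation_in_derived:
  assumes "b < N"
  shows "prod_encode (b, 0) \<in> derived (metacyclic q) (carrier (metacyclic q))"
proof -
  let ?t = "prod_encode (0, 1)" and ?s = "prod_encode (b, 0)"
  have c: "?t \<in> carrier (metacyclic q)" "?s \<in> carrier (metacyclic q)"
    using assms mersenne_ge q by auto
  have "?t \<otimes>\<^bsub>metacyclic q\<^esub> ?s = ?s \<otimes>\<^bsub>metacyclic q\<^esub> ?s \<otimes>\<^bsub>metacyclic q\<^esub> ?t"
    using assms q by (simp add: mult_2)
  then have "?s = ?t \<otimes>\<^bsub>metacyclic q\<^esub> ?s \<otimes>\<^bsub>metacyclic q\<^esub> inv\<^bsub>metacyclic q\<^esub> ?t \<otimes>\<^bsub>metacyclic q\<^esub> inv\<^bsub>metacyclic q\<^esub> ?s"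
    using c by (simp only: m_assoc m_closed inv_closed r_inv r_one)
  then show ?thesis
    unfolding derived_def using c by (intro generate.incl) blast
qed

text \<open>Translations die in the abelianization, leaving only powers of the image of
  \<open>(0, 1)\<close>.\<close>

lemma cyclic_metacyclic_abelianization:
  "cyclic_group (metacyclic q Mod derived (metacyclic q) (carrier (metacyclic q)))"
proof -
  let ?D = "derived (metacyclic q) (carrier (metacyclic q))"
  let ?t = "prod_encode (0, 1)"
  interpret D: normal ?D "metacyclic q" by (rule derived_self_is_normal)
  interpret Q: group "metacyclic q Mod ?D" by (rule D.factorgroup_is_group)
  interpret h: group_hom "metacyclic q" "metacyclic q Mod ?D" "(#>\<^bsub>metacyclic q\<^esub>) ?D"
    using D.r_coset_hom_Mod by unfold_locales
  have t: "?t \<in> carrier (metacyclic q)" using mersenne_ge q by simp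
  have T: "?D #>\<^bsub>metacyclic q\<^esub> ?t \<in> carrier (metacyclic q Mod ?D)"
    using t by (rule h.hom_closed)
  have "C \<in> range (\<lambda>n::int. (?D #>\<^bsub>metacyclic q\<^esub> ?t) [^]\<^bsub>metacyclic q Mod ?D\<^esub> n)"
    if "C \<in> carrier (metacyclic q Mod ?D)" for C
  proof -
    obtain x where x: "x \<in> carrier (metacyclic q)" "C = ?D #>\<^bsub>metacyclic q\<^esub> x"
      using \<open>C \<in> _\<close> unfolding FactGroup_def RCOSETS_def by auto
    obtain b k where b: "x = prod_encode (b, k)" "b < N" "k < q" using x by (elim metacyclicE)
    have "prod_encode (b, 0) \<in> ?D" by (rule metacyclic_translation_in_derived[OF b(2)])
    then have "?D #>\<^bsub>metacyclic q\<^esub> prod_encode (b, 0) = \<one>\<^bsub>metacyclic q Mod ?D\<^esub>"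
      using D.rcos_const by (simp add: FactGroup_def)
    moreover have "prod_encode (b, 0) \<in> carrier (metacyclic q)" using b q by auto
    ultimately have "C = \<one>\<^bsub>metacyclic q Mod ?D\<^esub> \<otimes>\<^bsub>metacyclic q Mod ?D\<^esub>
        (?D #>\<^bsub>metacyclic q\<^esub> ?t) [^]\<^bsub>metacyclic q Mod ?D\<^esub> k"
      unfolding x(2) b(1) metacyclic_decomp[OF b(2,3)]
      using t by (simp only: h.hom_mult h.hom_nat_pow nat_pow_closed)
    then have "C = (?D #>\<^bsub>metacyclic q\<^esub> ?t) [^]\<^bsub>metacyclic q Mod ?D\<^esub> k"
      using T by (simp only: Q.l_one Q.nat_pow_closed)
    then show ?thesis by (metis int_pow_int rangeI)
  qed
  then show ?thesis
    unfolding Q.cyclic_group by (intro bexI[OF _ T]) (use Q.int_pow_closed[OF T] in auto)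
qed

lemma metacyclic_rotation_hom:
  "(\<lambda>x. int (snd (prod_decode x))) \<in> hom (metacyclic q) (integer_mod_group q)"
  using q by (auto simp: hom_def carrier_integer_mod_group zmod_int elim!: metacyclicE)

text \<open>The exponent map to \<open>\<int>/q\<close> has an abelian target, so the derived
  subgroup consists of translations. These commute, so the second derived subgroup is
  trivial.\<close>

lemma solvable_metacyclic: "solvable (metacyclic q)"
proof -
  let ?D = "derived (metacyclic q) (carrier (metacyclic q))"
  let ?r = "\<lambda>x. int (snd (prod_decode x))"
  interpret r: group_hom "metacyclic q" "integer_mod_group q" ?r
    using metacyclic_rotation_hom group_metacyclic by (simp add: group_hom_def group_hom_axioms_def)
  have D: "subgroup ?D (metacyclic q)" by (rule derived_is_subgroup) simp
  have "?r ` ?D = derived (integer_mod_group q) (?r ` carrier (metacyclic q))"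
    using r.derived_img[of "carrier (metacyclic q)"] by simp
  also have "\<dots> = {\<one>\<^bsub>integer_mod_group q\<^esub>}"
    using r.hom_closed by (intro comm_group.derived_eq_singleton) auto
  finally have r: "?r ` ?D = {0}" by simp
  have ex: "\<exists>b. x = prod_encode (b, 0)" if "x \<in> ?D" for x
  proof -
    have "?r x \<in> {0}" unfolding r[symmetric] using that by (rule imageI)
    then have "prod_decode x = (fst (prod_decode x), 0)" by (simp add: prod_eq_iff)
    then show ?thesis using prod_decode_inverse[of x] by metis
  qed
  have "x \<otimes>\<^bsub>metacyclic q\<^esub> y = y \<otimes>\<^bsub>metacyclic q\<^esub> x" if "x \<in> ?D" "y \<in> ?D" for x y
    using ex[OF that(1)] ex[OF that(2)] by (auto simp: add.commute)
  then have "comm_group (metacyclic q\<lparr>carrier := ?D\<rparr>)"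
    using subgroup_imp_group[OF D] by (intro group.group_comm_groupI) auto
  then have "derived (metacyclic q\<lparr>carrier := ?D\<rparr>) ?D = {\<one>\<^bsub>metacyclic q\<^esub>}"
    using comm_group.derived_eq_singleton[of "metacyclic q\<lparr>carrier := ?D\<rparr>" ?D] by simp
  then have "(derived (metacyclic q) ^^ 2) (carrier (metacyclic q)) = {\<one>\<^bsub>metacyclic q\<^esub>}"
    using derived_consistent[OF subset_refl D] by (simp add: numeral_2_eq_2)
  then show ?thesis unfolding solvable_iff_trivial_derived_seq by blast
qed

end

section \<open>Coprimality of the orders\<close>

text \<open>The order of 2 modulo \<open>m\<close> divides both exponents, hence is 1, and
  \<open>m\<close> divides \<open>2 - 1\<close>.\<close>

lemma cong_1_if_coprime_exponents:
  fixes m :: nat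
  assumes "[2 ^ a = 1] (mod m)" "[2 ^ b = 1] (mod m)" "coprime a b"
  shows "m = 1"
proof -
  have "ord m 2 dvd a" "ord m 2 dvd b" using assms unfolding ord_divides by simp_all
  then have "ord m 2 = 1" using assms(3) by (meson coprime_common_divisor nat_dvd_1_iff_1)
  then have "[2 ^ 1 = (1::nat)] (mod m)" by (simp only: ord_divides dvd_refl)
  then have "m dvd 2 - 1" by (simp add: cong_altdef_nat)
  then show ?thesis by simp
qed

lemma mersenne_cong_of_dvd:
  fixes m :: nat
  assumes "m dvd 2 ^ a - 1"
  shows "[2 ^ a = 1] (mod m)"
  using assms by (simp add: cong_altdef_nat)

text \<open>The four pairs of factors of the two orders are compared. The prime \<open>q\<close> is
  too large to divide \<open>2 ^ p - 1\<close>. The Mersenne numbers are coprime because their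
  exponents are. If \<open>p\<close> divided \<open>2 ^ q - 1\<close>, the order of 2 modulo
  \<open>p\<close> would divide both \<open>q\<close> and, by Fermat, \<open>p - 1\<close>.\<close>

lemma coprime_order_metacyclic:
  assumes "prime p" "prime q" "2 ^ p < q"
  shows "coprime (order (metacyclic p)) (order (metacyclic q))"
proof -
  have "p < 2 ^ p" by (rule less_exp)
  with assms(3) have pq: "p < q" by linarith
  have p1: "p > 1" using assms(1) by (rule prime_gt_1_nat)
  have cop: "coprime p q" using assms(1,2) pq primes_coprime by blast
  have "coprime (2 ^ p - 1) q"
  proof -
    have "\<not> q dvd 2 ^ p - 1"
      using assms(3) p1 one_less_power[of "2::nat" p] by (auto dest!: dvd_imp_le)
    then show ?thesis using assms(2) by (simp add: prime_imp_coprime coprime_commute)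
  qed
  moreover have "coprime (2 ^ p - 1) (2 ^ q - (1::nat))"
  proof (rule coprimeI)
    fix m :: nat assume "m dvd 2 ^ p - 1" "m dvd 2 ^ q - 1"
    then show "is_unit m"
      using cong_1_if_coprime_exponents[OF _ _ cop] mersenne_cong_of_dvd by auto
  qed
  moreover have "coprime p (2 ^ q - 1)"
  proof (rule prime_imp_coprime[OF assms(1)], rule notI)
    assume dvd: "p dvd 2 ^ q - 1"
    \<comment> \<open>Fermat needs \<open>p\<close> odd; \<open>p = 2\<close> cannot divide the odd
      number \<open>2 ^ q - 1\<close>.\<close>
    have "\<not> p dvd 2"
    proof
      assume "p dvd 2"
      then have "p dvd 2 ^ q" using pq by (intro dvd_trans[OF _ dvd_power]) auto
      moreover have "2 ^ q = (2 ^ q - 1) + (1::nat)" by simp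
      ultimately have "p dvd 1" using dvd by (metis dvd_add_right_iff)
      then show False using p1 by simp
    qed
    then have "[2 ^ (p - 1) = 1] (mod p)" by (rule fermat_theorem[OF assms(1)])
    moreover have "coprime (p - 1) q"
    proof -
      have "\<not> q dvd p - 1" using pq p1 by (auto dest!: dvd_imp_le)
      then show ?thesis using assms(2) by (simp add: prime_imp_coprime coprime_commute)
    qed
    ultimately show False
      using cong_1_if_coprime_exponents mersenne_cong_of_dvd[OF dvd] p1 by blast
  qed
  ultimately show ?thesis using cop by (simp add: order_metacyclic)
qed

section \<open>A fast growing sequence of primes\<close>

text \<open>The exponential gap gives coprime orders through \<open>coprime_order_metacyclic\<close>
  and also keeps the sum of reciprocals small.\<close>

primrec tower_prime :: "nat \<Rightarrow> nat" where
  "tower_prime 0 = 2"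
| "tower_prime (Suc i) = (SOME p. prime p \<and> 2 ^ tower_prime i < p)"

lemma tower_prime_Suc: "prime (tower_prime (Suc i)) \<and> 2 ^ tower_prime i < tower_prime (Suc i)"
  unfolding tower_prime.simps using bigger_prime by (rule someI_ex)

lemma prime_tower_prime: "prime (tower_prime i)"
  using tower_prime_Suc by (cases i) auto

lemma tower_prime_less: "i < j \<Longrightarrow> 2 ^ tower_prime i < tower_prime j"
proof (induction j)
  case (Suc j)
  show ?case
  proof (cases "i = j")
    case False
    then have "2 ^ tower_prime i < tower_prime j" using Suc by simp
    also have "\<dots> < 2 ^ tower_prime j" by (rule less_exp)
    also have "\<dots> < tower_prime (Suc j)" using tower_prime_Suc by blast
    finally show ?thesis .
  qed (use tower_prime_Suc in simp)
qed simp

lemma tower_prime_ge: "2 ^ Suc i \<le> tower_prime i"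
proof (induction i)
  case (Suc i)
  have "2 * m \<le> 2 ^ m" if "m > 0" for m :: nat
    using that Suc_leI[OF less_exp[of "m - 1"]] by (cases m) simp_all
  then have "2 * tower_prime i \<le> 2 ^ tower_prime i"
    using prime_gt_0_nat[OF prime_tower_prime] by blast
  then show ?case using Suc tower_prime_Suc[of i] by simp
qed simp

section \<open>Homomorphisms and topological generators\<close>

lemma profinite_completion_component:
  assumes "f \<in> carrier (profinite_completion G)" "N \<in> fin_index_normal G"
  shows "f N \<in> carrier (G Mod N)"
proof -
  have "f \<in> (\<Pi>\<^sub>E N \<in> fin_index_normal G. carrier (G Mod N))"
    using assms(1) unfolding profinite_completion_def by simp
  then show ?thesis using assms(2) by blast
qed

text \<open>The elements of the completion with a prescribed \<open>N\<close>-component form a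
  nonempty open set, which the dense subgroup must meet.\<close>

lemma generate_FactGroup_of_dense:
  assumes "group G" and N: "N \<in> fin_index_normal G"
    and X: "X \<subseteq> carrier (profinite_completion G)"
    and dense: "profinite_completion_topology G closure_of generate (profinite_completion G) X
      = carrier (profinite_completion G)"
  shows "generate (G Mod N) ((\<lambda>f. f N) ` X) = carrier (G Mod N)"
proof -
  let ?P = "profinite_completion G" and ?T = "profinite_completion_topology G"
  interpret N: normal N G using N by (simp add: fin_index_normal_def)
  interpret P: group ?P by (rule group_profinite_completion) fact
  interpret Q: group "G Mod N" by (rule N.factorgroup_is_group)
  have "(\<lambda>f. f N) \<in> hom ?P (G Mod N)"
  proof (rule homI)
    fix f g assume "f \<in> carrier ?P" "g \<in> carrier ?P"
    then show "f N \<in> carrier (G Mod N)"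
      using N by (simp add: profinite_completion_component)
    show "(f \<otimes>\<^bsub>?P\<^esub> g) N = f N \<otimes>\<^bsub>G Mod N\<^esub> g N"
      using N by (simp add: profinite_completion_def)
  qed
  then interpret ev: group_hom ?P "G Mod N" "\<lambda>f. f N"
    by unfold_locales
  have "C \<in> (\<lambda>f. f N) ` generate ?P X" if C: "C \<in> carrier (G Mod N)" for C
  proof -
    obtain x where x: "x \<in> carrier G" "C = N #>\<^bsub>G\<^esub> x"
      using C by (auto simp: FactGroup_def RCOSETS_def)
    \<comment> \<open>The image of \<open>x\<close> under the canonical map from \<open>G\<close> to
      its completion witnesses nonemptiness.\<close>
    let ?f = "\<lambda>M\<in>fin_index_normal G. M #>\<^bsub>G\<^esub> x"
    have "?f \<in> carrier ?P"
      using x by (auto simp: profinite_completion_def fin_index_normal_def FactGroup_def RCOSETS_def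
          set_mult_rcoset_of_subgroup)
    then have f: "?f \<in> ?T closure_of generate ?P X" by (simp only: dense)
    have "openin ?T {f \<in> topspace ?T. f N \<in> {C}}"
    proof (rule openin_continuous_map_preimage)
      show "continuous_map ?T (discrete_topology (carrier (G Mod N))) (\<lambda>f. f N)"
        unfolding profinite_completion_topology_def
        using N by (intro continuous_map_from_subtopology continuous_map_product_projection)
    qed (use C in simp)
    moreover have "?f \<in> {f \<in> topspace ?T. f N \<in> {C}}"
      using N x \<open>?f \<in> carrier ?P\<close> by (simp add: topspace_profinite_completion_topology)
    ultimately have "\<exists>g. g \<in> generate ?P X \<and> g \<in> {f \<in> topspace ?T. f N \<in> {C}}"
      using f[unfolded in_closure_of] by meson
    then show ?thesis by auto
  qed
  then have "carrier (G Mod N) \<subseteq> (\<lambda>f. f N) ` generate ?P X" by (rule subsetI)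
  moreover have "(\<lambda>f. f N) ` generate ?P X \<subseteq> carrier (G Mod N)"
    using P.generate_incl[OF X] by (intro image_subsetI) (simp add: subset_iff)
  ultimately show ?thesis
    unfolding ev.generate_img[OF X] by (rule subset_antisym[rotated])
qed

text \<open>Modulo the common kernel of all \<open>\<rho> p\<close>, the group is generated by
  \<open>card X\<close> elements. A homomorphism of the family is determined by its values there,
  and each value has at most \<open>v\<close> possibilities. Bounding the values element by element
  allows \<open>v\<close> to be far smaller than the order of \<open>W\<close>.\<close>

lemma card_homs_le_power_top_gens:
  assumes G: "group G" and W: "group W" and fin: "finite (carrier W)" "finite P"
    and hom: "\<And>p. p \<in> P \<Longrightarrow> \<rho> p \<in> hom G W"
    and inj: "\<And>p p'. p \<in> P \<Longrightarrow> p' \<in> P \<Longrightarrow> (\<And>g. g \<in> carrier G \<Longrightarrow> \<rho> p g = \<rho> p' g) \<Longrightarrow> p = p'"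
    and bound: "\<And>g. g \<in> carrier G \<Longrightarrow> card ((\<lambda>p. \<rho> p g) ` P) \<le> v"
    and X: "finite X" "X \<subseteq> carrier (profinite_completion G)"
    and dense: "profinite_completion_topology G closure_of generate (profinite_completion G) X
      = carrier (profinite_completion G)"
  shows "card P \<le> v ^ card X"
proof -
  interpret G: group G by fact
  interpret W: group W by fact
  let ?H = "product_group P (\<lambda>_. W)"
  let ?h = "\<lambda>g. \<lambda>p\<in>P. \<rho> p g"
  interpret H: group ?H using W by simp
  have "?h \<in> hom G ?H"
    using hom by (auto simp: hom_def PiE_iff Pi_iff fun_eq_iff)
  then interpret h: group_hom G ?H ?h by unfold_locales
  \<comment> \<open>The common kernel of the whole family; its quotient embeds in the finite power
    of \<open>W\<close> indexed by \<open>P\<close>, so it has finite index.\<close>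
  define N where "N = kernel G ?H ?h"
  interpret N: normal N G unfolding N_def by (rule h.normal_kernel)
  have "finite (carrier (G Mod N))"
    unfolding N_def
  proof (rule inj_on_finite[OF h.FactGroup_inj_on])
    show "(\<lambda>X. the_elem (?h ` X)) ` carrier (G Mod kernel G ?H ?h) \<subseteq> carrier ?H"
      using h.FactGroup_hom by (auto simp: hom_def)
    show "finite (carrier ?H)" using fin by (auto intro: finite_PiE)
  qed
  then have N: "N \<in> fin_index_normal G"
    using N.normal_axioms by (simp add: fin_index_normal_def FactGroup_def)
  have "\<exists>x\<in>carrier G. f N = N #>\<^bsub>G\<^esub> x" if "f \<in> X" for f
    using profinite_completion_component[OF _ N] that X(2) by (fastforce simp: FactGroup_def RCOSETS_def)
  \<comment> \<open>\<open>r f\<close> lifts the \<open>N\<close>-component of the topological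
    generator \<open>f\<close> to \<open>G\<close>; by density these lifts generate \<open>G\<close>
    modulo \<open>N\<close>.\<close>
  then obtain r where r: "\<And>f. f \<in> X \<Longrightarrow> r f \<in> carrier G" "\<And>f. f \<in> X \<Longrightarrow> f N = N #>\<^bsub>G\<^esub> r f"
    by metis
  interpret q: group_hom G "G Mod N" "(#>\<^bsub>G\<^esub>) N"
    using N.r_coset_hom_Mod N.factorgroup_is_group G
    by (simp add: group_hom_def group_hom_axioms_def)
  have "(\<lambda>f. f N) ` X = (#>\<^bsub>G\<^esub>) N ` r ` X"
    unfolding image_image using r(2) by (intro image_cong) auto
  then have gen: "(#>\<^bsub>G\<^esub>) N ` generate G (r ` X) = carrier (G Mod N)"
    using generate_FactGroup_of_dense[OF G N X(2) dense] q.generate_img[of "r ` X"] r(1)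
    by (metis image_subsetI)
  let ?F = "\<lambda>p. \<lambda>f\<in>X. \<rho> p (r f)"
  have "inj_on ?F P"
  proof (rule inj_onI)
    fix p p' assume p: "p \<in> P" "p' \<in> P" and eq: "?F p = ?F p'"
    interpret p: group_hom G W "\<rho> p" using hom p by unfold_locales blast
    interpret p': group_hom G W "\<rho> p'" using hom p by unfold_locales blast
    \<comment> \<open>Two homomorphisms agree on a subgroup; as it contains the lifts, it contains
      all they generate.\<close>
    have "subgroup {g \<in> carrier G. \<rho> p g = \<rho> p' g} G"
      by (rule G.subgroupI) (auto intro: exI[of _ "\<one>\<^bsub>G\<^esub>"])
    moreover have "r ` X \<subseteq> {g \<in> carrier G. \<rho> p g = \<rho> p' g}"
      using r(1) eq by (auto simp: fun_eq_iff restrict_def) metis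
    ultimately have agree: "generate G (r ` X) \<subseteq> {g \<in> carrier G. \<rho> p g = \<rho> p' g}"
      using G.generate_subgroup_incl by blast
    show "p = p'"
    proof (rule inj[OF p])
      fix g assume g: "g \<in> carrier G"
      then have "N #>\<^bsub>G\<^esub> g \<in> carrier (G Mod N)" by simp
      then obtain y where y: "y \<in> generate G (r ` X)" "N #>\<^bsub>G\<^esub> g = N #>\<^bsub>G\<^esub> y"
        using gen by (metis (no_types, lifting) imageE)
      have "y \<in> carrier G" using y(1) agree by auto
      have "g \<in> N #>\<^bsub>G\<^esub> y" using y(2) G.rcos_self[OF g N.is_subgroup] by simp
      \<comment> \<open>The factor \<open>k\<close> lies in the common kernel, so both homomorphisms
        see only \<open>y\<close>.\<close>
      then obtain k where k: "k \<in> N" "g = k \<otimes>\<^bsub>G\<^esub> y" by (auto simp: r_coset_def)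
      have "k \<in> carrier G" and h: "?h k = \<one>\<^bsub>?H\<^esub>"
        using k(1) unfolding N_def kernel_def by blast+
      have "\<rho> p k = \<one>\<^bsub>W\<^esub>" "\<rho> p' k = \<one>\<^bsub>W\<^esub>"
        using fun_cong[OF h, of p] fun_cong[OF h, of p'] p by simp_all
      then show "\<rho> p g = \<rho> p' g"
        using k(2) y(1) agree \<open>y \<in> carrier G\<close> \<open>k \<in> carrier G\<close> by auto
    qed
  qed
  then have "card P = card (?F ` P)" by (simp add: card_image)
  also have "\<dots> \<le> card (\<Pi>\<^sub>E f\<in>X. (\<lambda>p. \<rho> p (r f)) ` P)"
    by (rule card_mono) (use X fin in \<open>auto intro!: finite_PiE\<close>)
  also have "\<dots> = (\<Prod>f\<in>X. card ((\<lambda>p. \<rho> p (r f)) ` P))"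
    using X by (simp add: card_PiE)
  also have "\<dots> \<le> (\<Prod>f\<in>X. v)"
    using bound r(1) by (intro prod_mono) auto
  finally show ?thesis by simp
qed

section \<open>The universal property of the free product\<close>

definition fp_eval :: "('b, 'm) monoid_scheme \<Rightarrow> ('i \<Rightarrow> 'a \<Rightarrow> 'b) \<Rightarrow> ('i \<times> 'a) list \<Rightarrow> 'b" where
  "fp_eval W \<phi> w = foldr (\<lambda>(i, x) y. \<phi> i x \<otimes>\<^bsub>W\<^esub> y) w \<one>\<^bsub>W\<^esub>"

text \<open>Evaluation is constant on the class of a word, so the image of the class is a singleton
  and \<open>the_elem\<close> reads off its value.\<close>

definition fp_lift :: "('b, 'm) monoid_scheme \<Rightarrow> ('i \<Rightarrow> 'a \<Rightarrow> 'b) \<Rightarrow> ('i \<times> 'a) list set \<Rightarrow> 'b" where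
  "fp_lift W \<phi> A = the_elem (fp_eval W \<phi> ` A)"

context
  fixes I :: "'i set" and G :: "'i \<Rightarrow> ('a, 'm) monoid_scheme"
    and W :: "('b, 'n) monoid_scheme" and \<phi> :: "'i \<Rightarrow> 'a \<Rightarrow> 'b"
  assumes G: "\<And>i. i \<in> I \<Longrightarrow> group (G i)" and W: "group W"
    and \<phi>: "\<And>i. i \<in> I \<Longrightarrow> \<phi> i \<in> hom (G i) W"
begin

interpretation W: group W by (rule W)

lemma fp_eval_closed: "w \<in> fp_words I G \<Longrightarrow> fp_eval W \<phi> w \<in> carrier W"
  by (induction w) (use \<phi> in \<open>auto simp: fp_words_def fp_eval_def hom_def Pi_iff\<close>)

lemma fp_eval_append:
  "u \<in> fp_words I G \<Longrightarrow> v \<in> fp_words I G \<Longrightarrow>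
    fp_eval W \<phi> (u @ v) = fp_eval W \<phi> u \<otimes>\<^bsub>W\<^esub> fp_eval W \<phi> v"
proof (induction u)
  case Nil
  then show ?case using fp_eval_closed by (simp add: fp_eval_def)
next
  case (Cons a u)
  obtain i x where a: "a = (i, x)" by (cases a)
  with Cons.prems have u: "u \<in> fp_words I G" and ix: "\<phi> i x \<in> carrier W"
    using \<phi> by (auto simp: fp_words_def hom_def)
  have "fp_eval W \<phi> ((a # u) @ v) = \<phi> i x \<otimes>\<^bsub>W\<^esub> fp_eval W \<phi> (u @ v)"
    by (simp add: fp_eval_def a)
  also have "\<dots> = (\<phi> i x \<otimes>\<^bsub>W\<^esub> fp_eval W \<phi> u) \<otimes>\<^bsub>W\<^esub> fp_eval W \<phi> v"
    using Cons u ix fp_eval_closed by (simp add: W.m_assoc)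
  finally show ?case by (simp add: fp_eval_def a)
qed

lemma fp_eval_cong: "fp_equiv I G u v \<Longrightarrow> fp_eval W \<phi> u = fp_eval W \<phi> v"
proof (induction rule: fp_equiv.induct)
  case (append u u' v v')
  then show ?case
    using fp_equiv_words[of I G, OF G] fp_eval_append by metis
next
  case (one i)
  then interpret i: group_hom "G i" W "\<phi> i"
    using G \<phi> W by (simp add: group_hom_def group_hom_axioms_def)
  show ?case by (simp add: fp_eval_def)
next
  case (mult i x y)
  then interpret i: group_hom "G i" W "\<phi> i"
    using G \<phi> W by (simp add: group_hom_def group_hom_axioms_def)
  show ?case using mult by (simp add: fp_eval_def W.m_assoc)
qed simp_all

lemma fp_lift_class:
  assumes "w \<in> fp_words I G"
  shows "fp_lift W \<phi> (fp_rel I G `` {w}) = fp_eval W \<phi> w"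
proof -
  have "w \<in> fp_rel I G `` {w}"
    using fp_equiv.refl[of w I G] assms by (simp add: fp_rel_def)
  moreover have "fp_eval W \<phi> v = fp_eval W \<phi> w" if "v \<in> fp_rel I G `` {w}" for v
    using that fp_eval_cong[of w v] by (simp add: fp_rel_def)
  ultimately have "fp_eval W \<phi> ` (fp_rel I G `` {w}) = {fp_eval W \<phi> w}"
    by blast
  then show ?thesis by (simp add: fp_lift_def)
qed

lemma fp_lift_letter:
  assumes "i \<in> I" "x \<in> carrier (G i)"
  shows "fp_lift W \<phi> (fp_rel I G `` {[(i, x)]}) = \<phi> i x"
proof -
  have "\<phi> i x \<in> carrier W" using \<phi> assms by (auto simp: hom_def)
  moreover have "[(i, x)] \<in> fp_words I G" using assms by (auto simp: fp_words_def)
  ultimately show ?thesis by (simp add: fp_lift_class) (simp add: fp_eval_def)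
qed

lemma fp_lift_hom: "fp_lift W \<phi> \<in> hom (free_product I G) W"
proof (rule homI)
  have C: "carrier (free_product I G) = (\<lambda>u. fp_rel I G `` {u}) ` fp_words I G"
    by (auto simp: free_product_def quotient_def)
  fix A assume "A \<in> carrier (free_product I G)"
  then obtain u where u: "u \<in> fp_words I G" "A = fp_rel I G `` {u}" by (auto simp: C)
  then show "fp_lift W \<phi> A \<in> carrier W"
    by (simp add: fp_lift_class fp_eval_closed)
  fix B assume "B \<in> carrier (free_product I G)"
  then obtain v where v: "v \<in> fp_words I G" "B = fp_rel I G `` {v}" by (auto simp: C)
  have "u @ v \<in> fp_words I G" using u v by (auto simp: fp_words_def)
  then show "fp_lift W \<phi> (A \<otimes>\<^bsub>free_product I G\<^esub> B) = fp_lift W \<phi> A \<otimes>\<^bsub>W\<^esub> fp_lift W \<phi> B"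
    using u v by (simp add: free_product_mult[of I G, OF G] fp_lift_class fp_eval_append)
qed

end

section \<open>Counting affine actions of the free product\<close>

text \<open>
  The permutations of \<open>X \<times> 'r\<close> that induce the affine maps of the free \<open>'r\<close>-module on \<open>X\<close>
  with a fixed linear part: a permutation \<open>\<pi>\<close> of the coordinates and a common scalar \<open>\<epsilon>\<close>.
\<close>

definition affine_maps :: "'x set \<Rightarrow> ('x \<Rightarrow> 'x) \<Rightarrow> 'r::comm_ring_1 \<Rightarrow> ('x \<times> 'r \<Rightarrow> 'x \<times> 'r) set" where
  "affine_maps X \<pi> \<epsilon> =
    (\<lambda>v. \<lambda>(x, a)\<in>X \<times> UNIV. (\<pi> x, \<epsilon> * a + v x)) ` (X \<rightarrow>\<^sub>E UNIV)"

lemma affine_mapsI: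
  assumes "\<And>x a. x \<in> X \<Longrightarrow> f (x, a) = (\<pi> x, \<epsilon> * a + v x)"
  shows "restrict f (X \<times> UNIV) \<in> affine_maps X \<pi> \<epsilon>"
proof -
  have "restrict f (X \<times> UNIV) = (\<lambda>(x, a)\<in>X \<times> UNIV. (\<pi> x, \<epsilon> * a + restrict v X x))"
    using assms by (auto simp: fun_eq_iff)
  then show ?thesis
    unfolding affine_maps_def by (intro image_eqI[of _ _ "restrict v X"]) auto
qed

text \<open>With the linear part fixed only the translation vector varies, so the bound is the size
  of the module.\<close>

lemma card_affine_maps_le:
  assumes "finite X"
  shows "finite (affine_maps X \<pi> (\<epsilon> :: 'r::{comm_ring_1,finite}))"
    and "card (affine_maps X \<pi> (\<epsilon> :: 'r)) \<le> CARD('r) ^ card X"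
proof -
  have fin: "finite (X \<rightarrow>\<^sub>E (UNIV :: 'r set))" using assms by (intro finite_PiE) auto
  then show "finite (affine_maps X \<pi> \<epsilon>)" by (simp add: affine_maps_def)
  have "card (affine_maps X \<pi> \<epsilon>) \<le> card (X \<rightarrow>\<^sub>E (UNIV :: 'r set))"
    unfolding affine_maps_def using fin by (rule card_image_le)
  also have "\<dots> = CARD('r) ^ card X" using assms by (simp add: card_PiE)
  finally show "card (affine_maps X \<pi> \<epsilon>) \<le> CARD('r) ^ card X" .
qed

lemma compose_affine_maps:
  assumes "\<rho> \<in> X \<rightarrow> X" "f \<in> affine_maps X \<pi> \<epsilon>" "g \<in> affine_maps X \<rho> \<delta>"
  shows "compose (X \<times> UNIV) f g \<in> affine_maps X (\<pi> \<circ> \<rho>) (\<epsilon> * \<delta>)"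
proof -
  obtain u v where
    f: "f = (\<lambda>(x, a)\<in>X \<times> UNIV. (\<pi> x, \<epsilon> * a + u x))" and
    g: "g = (\<lambda>(x, a)\<in>X \<times> UNIV. (\<rho> x, \<delta> * a + v x))"
    using assms by (auto simp: affine_maps_def)
  show ?thesis
    unfolding compose_def
    \<comment> \<open>The witness comes from expanding
      \<open>f (\<rho> x, \<delta> * a + v x)\<close>.\<close>
    by (rule affine_mapsI[where v = "\<lambda>x. \<epsilon> * v x + u (\<rho> x)"])
      (use assms(1) in \<open>auto simp: f g Pi_iff algebra_simps\<close>)
qed

section \<open>Families of affine actions\<close>

text \<open>The inverse group element supplies the inverse map; the restriction is there because
  members of \<open>Bij S\<close> are extensional.\<close>

lemma restrict_action_hom_BijGroup:
  assumes "group G"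
    and cl: "\<And>g x. g \<in> carrier G \<Longrightarrow> x \<in> S \<Longrightarrow> act g x \<in> S"
    and one: "\<And>x. x \<in> S \<Longrightarrow> act \<one>\<^bsub>G\<^esub> x = x"
    and mult: "\<And>g h x. g \<in> carrier G \<Longrightarrow> h \<in> carrier G \<Longrightarrow> x \<in> S \<Longrightarrow>
      act (g \<otimes>\<^bsub>G\<^esub> h) x = act g (act h x)"
  shows "(\<lambda>g. restrict (act g) S) \<in> hom G (BijGroup S)"
proof -
  interpret group G by fact
  have bij: "restrict (act g) S \<in> Bij S" if g: "g \<in> carrier G" for g
  proof -
    have "bij_betw (act g) S S"
      by (rule bij_betw_byWitness[where f' = "act (inv\<^bsub>G\<^esub> g)"])
        (use g in \<open>auto simp: cl one simp flip: mult\<close>)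
    then show ?thesis by (simp add: Bij_def cong: bij_betw_cong)
  qed
  show ?thesis
  proof (rule homI)
    fix g h assume gh: "g \<in> carrier G" "h \<in> carrier G"
    then have "restrict (act (g \<otimes>\<^bsub>G\<^esub> h)) S = compose S (restrict (act g) S) (restrict (act h) S)"
      by (auto simp: compose_def fun_eq_iff mult cl)
    then show "restrict (act (g \<otimes>\<^bsub>G\<^esub> h)) S = restrict (act g) S \<otimes>\<^bsub>BijGroup S\<^esub> restrict (act h) S"
      using bij gh by (simp add: BijGroup_def)
  qed (simp add: bij BijGroup_def)
qed

lemma finite_carrier_BijGroup:
  assumes "finite S"
  shows "finite (carrier (BijGroup S))"
proof (rule finite_subset)
  show "carrier (BijGroup S) \<subseteq> (S \<rightarrow>\<^sub>E S)"
    by (auto simp: BijGroup_def Bij_def PiE_def bij_betw_def)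
  show "finite (S \<rightarrow>\<^sub>E S)" using assms by (intro finite_PiE) auto
qed

text \<open>These model derivations for one fixed linear action: \<open>\<pi>\<close> and
  \<open>\<epsilon>\<close> depend on \<open>g\<close> but not on the member of the family.
  Separation on the carrier keeps \<open>card R\<close> from counting one homomorphism several times
  through its values elsewhere.\<close>

definition affine_hom_family ::
    "'x set \<Rightarrow> ('a, 'm) monoid_scheme \<Rightarrow> ('a \<Rightarrow> 'x \<times> 'r::comm_ring_1 \<Rightarrow> 'x \<times> 'r) set \<Rightarrow> bool" where
  "affine_hom_family X G R \<longleftrightarrow>
    finite R \<and> R \<subseteq> hom G (BijGroup (X \<times> UNIV)) \<and>
    (\<forall>\<phi>\<in>R. \<forall>\<psi>\<in>R. (\<forall>g\<in>carrier G. \<phi> g = \<psi> g) \<longrightarrow> \<phi> = \<psi>) \<and>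
    (\<forall>g\<in>carrier G. \<exists>\<pi> \<epsilon>. \<pi> \<in> X \<rightarrow> X \<and> (\<forall>\<phi>\<in>R. \<phi> g \<in> affine_maps X \<pi> \<epsilon>))"

lemma affine_hom_family_image:
  assumes "finite A" and hom: "\<And>p. p \<in> A \<Longrightarrow> F p \<in> hom G (BijGroup (X \<times> UNIV))"
    and inj: "\<And>p p'. p \<in> A \<Longrightarrow> p' \<in> A \<Longrightarrow> (\<And>g. g \<in> carrier G \<Longrightarrow> F p g = F p' g) \<Longrightarrow> p = p'"
    and affine: "\<And>g. g \<in> carrier G \<Longrightarrow>
      \<exists>\<pi> \<epsilon>. \<pi> \<in> X \<rightarrow> X \<and> (\<forall>p\<in>A. F p g \<in> affine_maps X \<pi> \<epsilon>)"
  shows "affine_hom_family X G (F ` A) \<and> card (F ` A) = card A"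
proof
  show "affine_hom_family X G (F ` A)"
    unfolding affine_hom_family_def
  proof (intro conjI ballI impI)
    fix \<phi> \<psi> assume "\<phi> \<in> F ` A" "\<psi> \<in> F ` A" "\<forall>g\<in>carrier G. \<phi> g = \<psi> g"
    then show "\<phi> = \<psi>" using inj by blast
  next
    fix g assume "g \<in> carrier G"
    from affine[OF this] show "\<exists>\<pi> \<epsilon>. \<pi> \<in> X \<rightarrow> X \<and> (\<forall>\<phi>\<in>F ` A. \<phi> g \<in> affine_maps X \<pi> \<epsilon>)"
      by blast
  qed (use assms(1) hom in auto)
  show "card (F ` A) = card A"
    using inj by (intro card_image inj_onI) metis
qed

text \<open>Choosing one member per factor gives a homomorphism of the free product. All choices
  share one linear part on each word, so their values at one element number at most the size of the
  module, and \<open>card_homs_le_power_top_gens\<close> applies.\<close>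

lemma prod_card_affine_homs_le:
  fixes I :: "'i set" and G :: "'i \<Rightarrow> ('a, 'm) monoid_scheme"
    and R :: "'i \<Rightarrow> ('a \<Rightarrow> 'x \<times> 'r \<Rightarrow> 'x \<times> 'r::{comm_ring_1,finite}) set"
  defines "\<Gamma> \<equiv> free_product I G"
  assumes I: "finite I" and G: "\<And>i. i \<in> I \<Longrightarrow> group (G i)" and X: "finite X"
    and R: "\<And>i. i \<in> I \<Longrightarrow> affine_hom_family X (G i) (R i)"
    and S: "finite S" "S \<subseteq> carrier (profinite_completion \<Gamma>)"
    and dense: "profinite_completion_topology \<Gamma> closure_of generate (profinite_completion \<Gamma>) S
      = carrier (profinite_completion \<Gamma>)"
  shows "(\<Prod>i\<in>I. card (R i)) \<le> (CARD('r) ^ card X) ^ card S"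
proof -
  let ?W = "BijGroup (X \<times> (UNIV :: 'r set))"
  let ?P = "\<Pi>\<^sub>E i\<in>I. R i"
  have W: "group ?W" by (rule group_BijGroup)
  have ph: "p i \<in> hom (G i) ?W" if "p \<in> ?P" "i \<in> I" for p i
    using that R by (fastforce simp: affine_hom_family_def)
  \<comment> \<open>The common linear part of a word is built up letter by letter, starting from the
    identity.\<close>
  have eval: "\<exists>\<pi> \<epsilon>. \<pi> \<in> X \<rightarrow> X \<and> (\<forall>p\<in>?P. fp_eval ?W p w \<in> affine_maps X \<pi> \<epsilon>)"
    if "w \<in> fp_words I G" for w
    using that
  proof (induction w)
    case Nil
    have "(\<lambda>x\<in>X \<times> UNIV. x) \<in> affine_maps X id (1 :: 'r)"
      by (rule affine_mapsI[where v = "\<lambda>_. 0"]) simp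
    moreover have "fp_eval ?W p [] = (\<lambda>x\<in>X \<times> UNIV. x)" for p :: "'i \<Rightarrow> 'a \<Rightarrow> 'x \<times> 'r \<Rightarrow> 'x \<times> 'r"
      by (simp add: fp_eval_def BijGroup_def)
    ultimately have "\<forall>p\<in>?P. fp_eval ?W p [] \<in> affine_maps X id 1" by metis
    moreover have "id \<in> X \<rightarrow> X" by simp
    ultimately show ?case by blast
  next
    case (Cons l w)
    then obtain i g where l: "l = (i, g)" "i \<in> I" "g \<in> carrier (G i)" and w: "w \<in> fp_words I G"
      by (cases l) (auto simp: fp_words_def)
    obtain \<rho> \<delta> where \<rho>: "\<rho> \<in> X \<rightarrow> X" "\<And>p. p \<in> ?P \<Longrightarrow> fp_eval ?W p w \<in> affine_maps X \<rho> \<delta>"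
      using Cons.IH[OF w] by blast
    obtain \<pi> \<epsilon> where \<pi>: "\<pi> \<in> X \<rightarrow> X" "\<And>\<phi>. \<phi> \<in> R i \<Longrightarrow> \<phi> g \<in> affine_maps X \<pi> \<epsilon>"
      using R[OF l(2)] l(3) unfolding affine_hom_family_def by blast
    have "fp_eval ?W p (l # w) \<in> affine_maps X (\<pi> \<circ> \<rho>) (\<epsilon> * \<delta>)" if p: "p \<in> ?P" for p
    proof -
      have "p i g \<in> carrier ?W" using hom_in_carrier[OF ph[OF p l(2)] l(3)] .
      moreover have "fp_eval ?W p w \<in> carrier ?W"
        using fp_eval_closed[OF G W ph[OF p] w] by blast
      ultimately have "fp_eval ?W p (l # w) = compose (X \<times> UNIV) (p i g) (fp_eval ?W p w)"
        by (simp add: fp_eval_def l(1) BijGroup_def)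
      moreover have "p i g \<in> affine_maps X \<pi> \<epsilon>" using p l(2) by (intro \<pi>(2)) (rule PiE_mem)
      ultimately show ?thesis
        using compose_affine_maps[OF \<rho>(1) _ \<rho>(2)[OF p]] by metis
    qed
    moreover have "\<pi> \<circ> \<rho> \<in> X \<rightarrow> X" using \<pi>(1) \<rho>(1) by auto
    ultimately show ?case by blast
  qed
  have "card ?P \<le> (CARD('r) ^ card X) ^ card S"
  proof (rule card_homs_le_power_top_gens[where \<rho> = "\<lambda>p. fp_lift ?W p"])
    show "group \<Gamma>" unfolding \<Gamma>_def using G by (rule group_free_product)
    show "finite (carrier ?W)" using X by (intro finite_carrier_BijGroup) auto
    show "finite ?P" using I R by (intro finite_PiE) (auto simp: affine_hom_family_def)
    show "fp_lift ?W p \<in> hom \<Gamma> ?W" if "p \<in> ?P" for p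
      unfolding \<Gamma>_def by (rule fp_lift_hom[OF G W ph[OF that]])
    show "p = p'" if p: "p \<in> ?P" "p' \<in> ?P"
      and eq: "\<And>g. g \<in> carrier \<Gamma> \<Longrightarrow> fp_lift ?W p g = fp_lift ?W p' g" for p p'
    proof (rule PiE_ext[OF p])
      fix i assume i: "i \<in> I"
      \<comment> \<open>One-letter words recover the chosen homomorphism on each factor.\<close>
      have "p i g = p' i g" if g: "g \<in> carrier (G i)" for g
      proof -
        have "fp_rel I G `` {[(i, g)]} \<in> carrier \<Gamma>"
          using i g by (auto simp: \<Gamma>_def free_product_def fp_words_def intro: quotientI)
        from eq[OF this] show ?thesis
          by (simp add: fp_lift_letter[of I G ?W p, OF G W ph[OF p(1)] i g]
              fp_lift_letter[of I G ?W p', OF G W ph[OF p(2)] i g])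
      qed
      moreover have "p i \<in> R i" "p' i \<in> R i" using p i by auto
      ultimately show "p i = p' i" using R[OF i] unfolding affine_hom_family_def by blast
    qed
    show "card ((\<lambda>p. fp_lift ?W p g) ` ?P) \<le> CARD('r) ^ card X" if g: "g \<in> carrier \<Gamma>" for g
    proof -
      obtain w where w: "w \<in> fp_words I G" "g = fp_rel I G `` {w}"
        using g by (auto simp: \<Gamma>_def free_product_def elim!: quotientE)
      obtain \<pi> \<epsilon> where "\<And>p. p \<in> ?P \<Longrightarrow> fp_eval ?W p w \<in> affine_maps X \<pi> \<epsilon>"
        using eval[OF w(1)] by blast
      moreover have "fp_lift ?W p g = fp_eval ?W p w" if "p \<in> ?P" for p
        unfolding w(2) using fp_lift_class[of I G ?W p, OF G W ph[OF that] w(1)] .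
      ultimately have "(\<lambda>p. fp_lift ?W p g) ` ?P \<subseteq> affine_maps X \<pi> \<epsilon>"
        by (intro image_subsetI) simp
      then show ?thesis
        using card_affine_maps_le[OF X] by (meson card_mono le_trans)
    qed
  qed (fact W S dense)+
  then show ?thesis using I by (simp add: card_PiE)
qed

section \<open>Large families on the factors\<close>

text \<open>
  At each coordinate, \<open>c\<close> ranges over the homomorphisms \<open>\<int>/3 \<rightarrow> \<int>/3\<close> and \<open>d\<close> over the inner
  derivations.
\<close>

definition reflection_act :: "('x \<Rightarrow> 3) \<Rightarrow> ('x \<Rightarrow> 3) \<Rightarrow> nat \<Rightarrow> 'x \<times> 3 \<Rightarrow> 'x \<times> 3" where
  "reflection_act c d g = (\<lambda>(x, a). case prod_decode g of (b, k) \<Rightarrow>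
    (x, (- 1) ^ k * a + (of_nat b * c x + (1 - (- 1) ^ k) * d x)))"

text \<open>Translations in \<open>metacyclic 2\<close> live modulo \<open>2 ^ 2 - 1 = 3\<close>,
  the characteristic of the coefficients, so \<open>of_nat b\<close> respects their
  addition.\<close>

lemma of_nat_mod_3: "(of_nat (m mod 3) :: 3) = of_nat m"
proof -
  have "(of_nat m :: 3) = of_nat (3 * (m div 3) + m mod 3)" by simp
  also have "\<dots> = 3 * of_nat (m div 3) + of_nat (m mod 3)" by (simp only: of_nat_add of_nat_mult of_nat_numeral)
  also have "(3 :: 3) = 0" by simp
  finally show ?thesis by simp
qed

lemma neg_one_power_mod_2: "(- 1 :: 'r::ring_1) ^ (m mod 2) = (- 1) ^ m"
  by (cases "even m") (simp_all add: odd_iff_mod_2_eq_one)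

text \<open>Doubling on \<open>\<int>/3\<close> is thus the sign action, which turns the twist
  \<open>2 ^ k\<close> of \<open>metacyclic 2\<close> into the scalar
  \<open>(- 1) ^ k\<close>.\<close>

lemma two_eq_neg_one_3: "(2 :: 3) = - 1"
  by simp

lemma exists_affine_hom_family_metacyclic_2:
  assumes X: "finite X"
  shows "\<exists>R :: (nat \<Rightarrow> 'x \<times> 3 \<Rightarrow> 'x \<times> 3) set.
    affine_hom_family X (metacyclic 2) R \<and> card R = 3 ^ (2 * card X)"
proof -
  let ?U = "X \<rightarrow>\<^sub>E (UNIV :: 3 set)"
  let ?F = "\<lambda>(c, d) g. restrict (reflection_act c d g) (X \<times> (UNIV :: 3 set))"
  have U: "finite ?U" "card ?U = 3 ^ card X"
    using X by (auto simp: card_PiE intro: finite_PiE)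
  have "affine_hom_family X (metacyclic 2) (?F ` (?U \<times> ?U)) \<and> card (?F ` (?U \<times> ?U)) = card (?U \<times> ?U)"
  proof (rule affine_hom_family_image)
    show "finite (?U \<times> ?U)" using U by blast
    show "?F p \<in> hom (metacyclic 2) (BijGroup (X \<times> UNIV))" for p
    proof (cases p)
      case (Pair c d)
      have "reflection_act c d (g \<otimes>\<^bsub>metacyclic 2\<^esub> h) z = reflection_act c d g (reflection_act c d h z)"
        if gh: "g \<in> carrier (metacyclic 2)" "h \<in> carrier (metacyclic 2)" for g h z
      proof -
        obtain b k b' k' where g: "g = prod_encode (b, k)" and h: "h = prod_encode (b', k')"
          using gh by (elim metacyclicE)
        obtain x a where z: "z = (x, a)" by (cases z)
        have "(of_nat ((b + 2 ^ k * b') mod 3) :: 3) = of_nat b + (- 1) ^ k * of_nat b'"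
          unfolding of_nat_mod_3 of_nat_add of_nat_mult of_nat_power of_nat_numeral two_eq_neg_one_3 ..
        then show ?thesis
          by (simp add: g h z reflection_act_def neg_one_power_mod_2 power_add algebra_simps)
      qed
      then show ?thesis
        unfolding Pair split
        by (intro restrict_action_hom_BijGroup group_metacyclic)
          (auto simp: reflection_act_def split: prod.splits)
    qed
    show "p = p'" if p: "p \<in> ?U \<times> ?U" "p' \<in> ?U \<times> ?U"
      and eq: "\<And>g. g \<in> carrier (metacyclic 2) \<Longrightarrow> ?F p g = ?F p' g" for p p'
    proof -
      obtain c d c' d' where pp: "p = (c, d)" "p' = (c', d')" by (cases p, cases p')
      have "c x = c' x \<and> d x = d' x" if x: "x \<in> X" for x
      proof -
        have "reflection_act c d g (x, 0) = reflection_act c' d' g (x, 0)"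
          if "g \<in> carrier (metacyclic 2)" for g
          using fun_cong[OF eq[OF that], of "(x, 0)"] x by (simp add: pp)
        \<comment> \<open>The translation by 1 reveals \<open>c\<close> and the reflection reveals
          \<open>2 * d\<close>; 2 is invertible in \<open>\<int>/3\<close>, so both parameters are
          independent.\<close>
        from this[of "prod_encode (1, 0)"] this[of "prod_encode (0, 1)"]
        have "c x = c' x" "2 * d x = 2 * d' x" by (simp_all add: reflection_act_def)
        then show ?thesis unfolding two_eq_neg_one_3 by simp
      qed
      then show ?thesis using p unfolding pp by (auto intro: PiE_ext)
    qed
    fix g assume "g \<in> carrier (metacyclic 2)"
    obtain b k where g: "prod_decode g = (b, k)" by (cases "prod_decode g")
    have "?F p g \<in> affine_maps X id ((- 1) ^ k)" for p
      by (cases p) (auto simp: reflection_act_def g intro!: affine_mapsI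
          [where v = "\<lambda>x. of_nat b * fst p x + (1 - (- 1) ^ k) * snd p x"])
    then show "\<exists>\<pi> \<epsilon>. \<pi> \<in> X \<rightarrow> X \<and> (\<forall>p\<in>?U \<times> ?U. ?F p g \<in> affine_maps X \<pi> \<epsilon>)"
      by (intro exI[of _ id] exI) auto
  qed
  moreover have "card (?U \<times> ?U) = 3 ^ (2 * card X)"
    using U by (simp add: card_cartesian_product power_add mult_2)
  ultimately have "affine_hom_family X (metacyclic 2) (?F ` (?U \<times> ?U)) \<and>
      card (?F ` (?U \<times> ?U)) = 3 ^ (2 * card X)"
    by (simp only:)
  then show ?thesis by (rule exI)
qed

text \<open>
  The cyclic shift by \<open>s\<close>, conjugated by the translation by \<open>u\<close>. Only the class of \<open>u\<close> modulo
  invariant vectors matters, so \<open>u\<close> is normalised below to vanish on \<open>{..<s}\<close>, a set of orbit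
  representatives.
\<close>

definition shift_act :: "nat \<Rightarrow> nat \<Rightarrow> (nat \<Rightarrow> 'r::comm_ring_1) \<Rightarrow> nat \<Rightarrow> nat \<times> 'r \<Rightarrow> nat \<times> 'r" where
  "shift_act m s u g = (\<lambda>(x, a). let y = (x + snd (prod_decode g) * s) mod m
    in (y, a + (u y - u x)))"

text \<open>Translations have trivial linear part and the rotation permutes the coordinates in
  \<open>s\<close> orbits of length \<open>q\<close>. Inner derivations correspond to vectors modulo
  the \<open>3 ^ s\<close> invariant ones, whence the exponent.\<close>

lemma exists_affine_hom_family_metacyclic:
  assumes q: "q \<ge> 2" and s: "s > 0"
  shows "\<exists>R :: (nat \<Rightarrow> nat \<times> 3 \<Rightarrow> nat \<times> 3) set.
    affine_hom_family {..<q * s} (metacyclic q) R \<and> card R = 3 ^ (q * s - s)"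
proof -
  let ?X = "{..<q * s}"
  let ?U = "{s..<q * s} \<rightarrow>\<^sub>E (UNIV :: 3 set)"
  let ?z = "\<lambda>u x. if x < s then 0 else u x :: 3"
  let ?F = "\<lambda>u g. restrict (shift_act (q * s) s (?z u) g) (?X \<times> (UNIV :: 3 set))"
  have qs: "q * s > 0" using q s by simp
  have U: "finite ?U" "card ?U = 3 ^ (q * s - s)"
    by (auto simp: card_PiE intro: finite_PiE)
  have "affine_hom_family ?X (metacyclic q) (?F ` ?U) \<and> card (?F ` ?U) = card ?U"
  proof (rule affine_hom_family_image)
    show "finite ?U" by (rule U)
    show "?F u \<in> hom (metacyclic q) (BijGroup (?X \<times> UNIV))" for u
    proof (rule restrict_action_hom_BijGroup[OF group_metacyclic[OF q]])
      fix g h and z :: "nat \<times> 3"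
      assume gh: "g \<in> carrier (metacyclic q)" "h \<in> carrier (metacyclic q)"
      obtain b k b' k' where g: "g = prod_encode (b, k)" and h: "h = prod_encode (b', k')"
        using gh by (elim metacyclicE)
      obtain x a where z: "z = (x, a)" by (cases z)
      \<comment> \<open>Reducing the exponent modulo \<open>q\<close> is harmless because
        \<open>q\<close> shifts by \<open>s\<close> return to the start.\<close>
      have "(x + (k + k') mod q * s) mod (q * s) = (x + (k + k') * s mod (q * s)) mod (q * s)"
        by (simp add: mod_mult_mult2)
      also have "\<dots> = ((x + k' * s) mod (q * s) + k * s) mod (q * s)"
        by (simp add: mod_simps algebra_simps)
      finally show "shift_act (q * s) s (?z u) (g \<otimes>\<^bsub>metacyclic q\<^esub> h) z
          = shift_act (q * s) s (?z u) g (shift_act (q * s) s (?z u) h z)"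
        by (simp add: g h z shift_act_def Let_def)
    qed (use qs in \<open>auto simp: shift_act_def Let_def\<close>)
    show "u = u'" if u: "u \<in> ?U" "u' \<in> ?U"
      and eq: "\<And>g. g \<in> carrier (metacyclic q) \<Longrightarrow> ?F u g = ?F u' g" for u u'
    proof (rule PiE_ext[OF u])
      fix y assume y: "y \<in> {s..<q * s}"
      \<comment> \<open>This element moves the representative \<open>y mod s\<close> to
        \<open>y\<close>. The normalised vector vanishes at the representative, so the second
        component becomes \<open>u y\<close>.\<close>
      let ?g = "prod_encode (0, y div s)"
      have "y div s < q" using y by (simp add: less_mult_imp_div_less)
      then have E: "?F u ?g = ?F u' ?g" using mersenne_ge[OF q] by (intro eq) auto
      have "y mod s < s" using s by simp
      moreover from this have "y mod s < q * s" using y by auto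
      ultimately have "shift_act (q * s) s (?z u) ?g (y mod s, 0) = shift_act (q * s) s (?z u') ?g (y mod s, 0)"
        using fun_cong[OF E, of "(y mod s, 0)"] by simp
      then show "u y = u' y"
        using y \<open>y mod s < s\<close> by (simp add: shift_act_def Let_def)
    qed
    fix g assume "g \<in> carrier (metacyclic q)"
    let ?\<pi> = "\<lambda>x. (x + snd (prod_decode g) * s) mod (q * s)"
    have "?F u g \<in> affine_maps ?X ?\<pi> 1" for u
      by (rule affine_mapsI[where v = "\<lambda>x. ?z u (?\<pi> x) - ?z u x"]) (simp add: shift_act_def Let_def)
    moreover have "?\<pi> \<in> ?X \<rightarrow> ?X" using qs by simp
    ultimately show "\<exists>\<pi> \<epsilon>. \<pi> \<in> ?X \<rightarrow> ?X \<and> (\<forall>u\<in>?U. ?F u g \<in> affine_maps ?X \<pi> \<epsilon>)"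
      by blast
  qed
  then have "affine_hom_family ?X (metacyclic q) (?F ` ?U) \<and> card (?F ` ?U) = 3 ^ (q * s - s)"
    by (simp only: U)
  then show ?thesis by (rule exI)
qed

section \<open>The final count\<close>

text \<open>By \<open>tower_prime_ge\<close> the reciprocals are dominated by a geometric series
  with sum below 1.\<close>

lemma sum_div_tower_prime_less:
  assumes "m > 0"
  shows "(\<Sum>i\<in>{1..<n}. m div tower_prime i) < m"
proof -
  have geo: "(\<Sum>i\<in>{1..<n}. (1 / 2) ^ Suc i) < (1 :: real)"
  proof -
    have "(\<Sum>i\<in>{1..<n}. (1 / 2) ^ Suc i) \<le> (\<Sum>i<n. (1 / 2) ^ Suc i :: real)"
      by (rule sum_mono2) auto
    also have "\<dots> = 1 - (1 / 2) ^ n" by (induction n) auto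
    finally show ?thesis by (smt (verit) zero_less_power divide_pos_pos)
  qed
  have "real (\<Sum>i\<in>{1..<n}. m div tower_prime i) \<le> (\<Sum>i\<in>{1..<n}. real m * (1 / 2) ^ Suc i)"
    unfolding of_nat_sum
  proof (rule sum_mono)
    fix i
    have "real (m div tower_prime i) \<le> real m / real (tower_prime i)" by (rule of_nat_div_le_of_nat)
    also have "\<dots> \<le> real m / real (2 ^ Suc i)"
    proof (rule divide_left_mono)
      show "real (2 ^ Suc i) \<le> real (tower_prime i)"
        using tower_prime_ge[of i] by (simp only: of_nat_le_iff)
      show "0 < real (tower_prime i) * real (2 ^ Suc i)"
        using prime_gt_0_nat[OF prime_tower_prime[of i]] by simp
    qed simp
    also have "\<dots> = real m * (1 / 2) ^ Suc i" by (simp add: power_divide)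
    finally show "real (m div tower_prime i) \<le> real m * (1 / 2) ^ Suc i" .
  qed
  also have "\<dots> = real m * (\<Sum>i\<in>{1..<n}. (1 / 2) ^ Suc i)" by (rule sum_distrib_left[symmetric])
  also have "\<dots> < real m * 1" using geo assms by (intro mult_strict_left_mono) auto
  finally show ?thesis by linarith
qed

theorem theorem4:
  fixes n :: nat
  assumes "n \<ge> 1"
  shows "\<exists>G :: nat \<Rightarrow> nat monoid.
    (\<forall>i\<in>{1..n}. group (G i) \<and> finite (carrier (G i)) \<and> solvable (G i)) \<and>
    (\<forall>i\<in>{1..n}. \<forall>j\<in>{1..n}. i \<noteq> j \<longrightarrow> coprime (order (G i)) (order (G j))) \<and>
    (\<forall>i\<in>{1..n}. min_gens (G i) = 2 \<and>
       cyclic_group (G i Mod derived (G i) (carrier (G i)))) \<and>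
    min_top_gens (profinite_completion (free_product {1..n} G))
      (profinite_completion_topology (free_product {1..n} G)) \<ge> enat (n + 1)"
proof -
  \<comment> \<open>The index shift makes the first factor \<open>metacyclic 2\<close>, which is
    \<open>S_3\<close>.\<close>
  let ?q = "\<lambda>i. tower_prime (i - 1)"
  define G where "G = (\<lambda>i. metacyclic (?q i))"
  let ?\<Gamma> = "free_product {1..n} G"
  have q: "tower_prime i \<ge> 2" for i using prime_tower_prime by (rule prime_ge_2_nat)
  have coprime_less: "coprime (order (G i)) (order (G j))" if "1 \<le> i" "i < j" for i j
    unfolding G_def using that
    by (intro coprime_order_metacyclic prime_tower_prime tower_prime_less) auto
  have coprime: "coprime (order (G i)) (order (G j))" if "i \<in> {1..n}" "j \<in> {1..n}" "i \<noteq> j" for i j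
    using that coprime_less[of i j] coprime_less[of j i]
    by (cases "i < j") (auto simp: coprime_commute)
  \<comment> \<open>The common rank of the module. It is divisible by the primes of all factors
    after the first, so each of them can act in free orbits; the first factor fixes all
    coordinates.\<close>
  define m where "m = (\<Prod>i\<in>{1..<n}. tower_prime i)"
  have m: "m > 0" unfolding m_def using prime_gt_0_nat[OF prime_tower_prime] by (intro prod_pos) auto
  \<comment> \<open>The number of homomorphisms found on factor \<open>i\<close> is
    \<open>3 ^ e i\<close>.\<close>
  define e where "e i = (if i = 1 then 2 * m else m - m div ?q i)" for i
  have "\<exists>R :: (nat \<Rightarrow> nat \<times> 3 \<Rightarrow> nat \<times> 3) set. affine_hom_family {..<m} (G i) R \<and> card R = 3 ^ e i"
    if i: "i \<in> {1..n}" for i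
  proof (cases "i = 1")
    case True
    then show ?thesis
      using exists_affine_hom_family_metacyclic_2[of "{..<m}"] by (simp add: G_def e_def)
  next
    case False
    then have "i - 1 \<in> {1..<n}" using i by auto
    then have "?q i dvd m" unfolding m_def by (intro dvd_prodI) auto
    then have "?q i * (m div ?q i) = m" by simp
    moreover from this have "m div ?q i > 0" using m by (metis gr0I mult_0_right)
    ultimately show ?thesis
      using exists_affine_hom_family_metacyclic[OF q[of "i - 1"], of "m div ?q i"] False
      by (simp only: G_def e_def if_False)
  qed
  then obtain R :: "nat \<Rightarrow> (nat \<Rightarrow> nat \<times> 3 \<Rightarrow> nat \<times> 3) set" where
    "\<forall>i\<in>{1..n}. affine_hom_family {..<m} (G i) (R i) \<and> card (R i) = 3 ^ e i"
    using bchoice[of "{1..n}" "\<lambda>i R. affine_hom_family {..<m} (G i) R \<and> card R = 3 ^ e i"] by blast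
  then have R: "\<And>i. i \<in> {1..n} \<Longrightarrow> affine_hom_family {..<m} (G i) (R i)"
      "\<And>i. i \<in> {1..n} \<Longrightarrow> card (R i) = 3 ^ e i"
    by blast+
  \<comment> \<open>The exponents sum to \<open>(n + 1) * m\<close> minus the quotients
    \<open>m div ?q i\<close> of the later factors, which together stay below
    \<open>m\<close>.\<close>
  have "n * m < (\<Sum>i\<in>{1..n}. e i)"
  proof -
    have "{1..n} = insert 1 (Suc ` {1..<n})" using assms by (auto simp: image_Suc_atLeastLessThan)
    then have "(\<Sum>i\<in>{1..n}. e i) = e 1 + (\<Sum>i\<in>Suc ` {1..<n}. e i)" by simp
    also have "\<dots> = 2 * m + (\<Sum>i\<in>{1..<n}. m - m div tower_prime i)"
      by (simp add: sum.reindex e_def del: image_Suc_atLeastLessThan)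
    \<comment> \<open>Adding the quotients on the left undoes the truncated subtractions
      exactly.\<close>
    finally have "(\<Sum>i\<in>{1..n}. e i) + (\<Sum>i\<in>{1..<n}. m div tower_prime i) = 2 * m + (n - 1) * m"
      by (simp flip: sum.distrib)
    moreover have "2 * m + (n - 1) * m = m + n * m" using assms by (cases n) auto
    ultimately show ?thesis using sum_div_tower_prime_less[OF m, of n] by linarith
  qed
  then have big: "(3 ^ m) ^ n < (\<Prod>i\<in>{1..n}. card (R i))"
  proof -
    have "(3 ^ m) ^ n = (3 :: nat) ^ (n * m)" by (simp add: mult.commute flip: power_mult)
    also have "\<dots> < 3 ^ (\<Sum>i\<in>{1..n}. e i)" using \<open>n * m < _\<close> by (intro power_strict_increasing) auto
    also have "\<dots> = (\<Prod>i\<in>{1..n}. card (R i))" unfolding power_sum using R(2) by (intro prod.cong) auto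
    finally show ?thesis .
  qed
  have "enat (n + 1) \<le> min_top_gens (profinite_completion ?\<Gamma>) (profinite_completion_topology ?\<Gamma>)"
    unfolding min_top_gens_def
  proof (rule INF_greatest)
    fix S assume S: "S \<in> {X. X \<subseteq> carrier (profinite_completion ?\<Gamma>) \<and>
      profinite_completion_topology ?\<Gamma> closure_of generate (profinite_completion ?\<Gamma>) X
        = carrier (profinite_completion ?\<Gamma>)}"
    show "enat (n + 1) \<le> set_size S"
    proof (cases "finite S")
      case True
      have "(\<Prod>i\<in>{1..n}. card (R i)) \<le> (CARD(3) ^ card {..<m}) ^ card S"
      proof (rule prod_card_affine_homs_le)
        show "group (G i)" for i unfolding G_def using q by (rule group_metacyclic)
        show "S \<subseteq> carrier (profinite_completion ?\<Gamma>)"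
          "profinite_completion_topology ?\<Gamma> closure_of generate (profinite_completion ?\<Gamma>) S
            = carrier (profinite_completion ?\<Gamma>)"
          using S by blast+
      qed (simp_all add: True R(1))
      \<comment> \<open>The module has \<open>3 ^ m\<close> elements, so comparing exponents forces
        more than \<open>n\<close> generators.\<close>
      with big have "(3 ^ m) ^ n < (3 ^ m :: nat) ^ card S" by simp
      moreover have "1 < (3 ^ m :: nat)" using m by (intro one_less_power) auto
      ultimately have "n < card S" by (rule power_less_imp_less_exp[rotated])
      then show ?thesis using True by (simp add: set_size_def)
    qed (simp add: set_size_def)
  qed
  moreover have "group (G i) \<and> finite (carrier (G i)) \<and> solvable (G i) \<and> min_gens (G i) = 2 \<and>
      cyclic_group (G i Mod derived (G i) (carrier (G i)))" for i
    unfolding G_def using q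
    by (simp add: group_metacyclic finite_metacyclic solvable_metacyclic min_gens_metacyclic
        cyclic_metacyclic_abelianization)
  ultimately show ?thesis using coprime by blast
qed

end
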